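(* Let $\mathbf{x}=(x_1,x_2,x_3,x_4)\in\mathbb{R}^4$ be a tuple such that the sequence $(x_n)_{n\ge1}$ defined by $x_{n+4}=\max\{x_{n+3},x_{n+2},x_{n+1},0\}-x_n$ for $n\ge1$ is not periodic, and let $\mathcal{U}$ be an arbitrary neighbourhood of $\mathbf{x}$ in $\mathbb{R}^4$. Then there are tuples in $\mathcal{U}$ that generate, under the same recurrence, periodic sequences of arbitrarily large period; that is, for every $N\in\mathbb{N}$ there is a tuple $(y_1,y_2,y_3,y_4)\in\mathcal{U}$ such that the sequence defined by $y_{n+4}=\max\{y_{n+3},y_{n+2},y_{n+1},0\}-y_n$ for $n\ge 1$ is periodic with period greater than $N$.
   Context: A tuple $(y_1,y_2,y_3,y_4)\in\mathbb{R}^4$ generates the sequence $(y_n)_{n\ge1}$ obtained from the recurrence $y_{n+4}=\max\{y_{n+3},y_{n+2},y_{n+1},0\}-y_n$. A sequence is periodic if there is $p\ge1$ with $y_{n+p}=y_n$ for all $n\ge1$; its period is the least such $p$. *)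

theory Defs
  imports "HOL-Analysis.Analysis"
begin

(* Sequences are 0-based: index n here is the mathematical index n + 1,
   so the initial tuple sits at indices 0, 1, 2, 3. *)
fun max_seq :: "real ^ 4 \<Rightarrow> nat \<Rightarrow> real" where
  "max_seq y 0 = y $ 1"
| "max_seq y (Suc 0) = y $ 2"
| "max_seq y (Suc (Suc 0)) = y $ 3"
| "max_seq y (Suc (Suc (Suc 0))) = y $ 4"
| "max_seq y (Suc (Suc (Suc (Suc n)))) =
     Max {max_seq y (Suc (Suc (Suc n))), max_seq y (Suc (Suc n)), max_seq y (Suc n), 0}
       - max_seq y n"

definition periodic :: "(nat \<Rightarrow> 'a) \<Rightarrow> bool" where
  "periodic s \<longleftrightarrow> (\<exists>p\<ge>1. \<forall>n. s (n + p) = s n)"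

(* Unspecified if s is not periodic. *)
definition period :: "(nat \<Rightarrow> 'a) \<Rightarrow> nat" where
  "period s = (LEAST p. p \<ge> 1 \<and> (\<forall>n. s (n + p) = s n))"

end

(* The max-type recurrence is the tropical form of a Lyness recurrence, and the tropical form
   of the Lyness invariant bounds every orbit. If the initial values are rational, the orbit
   lies in a lattice, hence visits finitely many states, and it is periodic because the
   recurrence can be run backwards. Rational tuples approximating x cannot all have periods
   at most N: otherwise N! would be a period of all of them and, by continuity, of x. *)
theory Submission
  imports Defs
begin

lemma max_seq_rec:
  "max_seq y (n + 4) =
     max (max (max_seq y (n + 3)) (max_seq y (n + 2))) (max (max_seq y (n + 1)) 0) - max_seq y n"
  by (simp add: eval_nat_numeral max.assoc)

(* The tropical form of (1 + a + b + c + d) (1 + 1/a) (1 + 1/b) (1 + 1/c) (1 + 1/d). *)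
definition lyness_invariant :: "real \<Rightarrow> real \<Rightarrow> real \<Rightarrow> real \<Rightarrow> real" where
  "lyness_invariant a b c d =
     max (max (max a b) (max c d)) 0 + max 0 (-a) + max 0 (-b) + max 0 (-c) + max 0 (-d)"

text \<open>Let \<open>M\<close> be the maximum in the recurrence. The terms
  \<open>max 0 (-b)\<close>, \<open>max 0 (-c)\<close>, \<open>max 0 (-d)\<close> occur on both
  sides, and what remains on either side equals
  \<open>M + max 0 (-a) + max 0 (a - M)\<close>.\<close>

lemma lyness_invariant_step:
  "lyness_invariant b c d (max (max d c) (max b 0) - a) = lyness_invariant a b c d"
proof -
  define M where "M = max (max d c) (max b 0)"
  have "max (max (max b c) (max d (M - a))) 0 = max M (M - a)"
    "max (max (max a b) (max c d)) 0 = max a M"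
    by (simp_all only: M_def max.assoc max.commute max.left_commute)
  moreover have "max M (M - a) + max 0 (- (M - a)) = max a M + max 0 (- a)"
    by linarith
  ultimately show ?thesis
    unfolding lyness_invariant_def M_def[symmetric] by linarith
qed

text \<open>The leading maximum bounds \<open>a\<close> from above, the summand
  \<open>max 0 (-a)\<close> bounds it from below, and all other summands are nonnegative. The first
  argument suffices because every term of the sequence opens some window of four.\<close>

lemma abs_le_lyness_invariant: "\<bar>a\<bar> \<le> lyness_invariant a b c d"
proof -
  have "a \<le> max (max (max a b) (max c d)) 0" "0 \<le> max (max (max a b) (max c d)) 0"
    by (simp_all add: le_max_iff_disj)
  then show ?thesis unfolding lyness_invariant_def by linarith
qed

lemma max_seq_bounded: "\<bar>max_seq y n\<bar> \<le> lyness_invariant (y $ 1) (y $ 2) (y $ 3) (y $ 4)"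
proof -
  have "lyness_invariant (max_seq y n) (max_seq y (n + 1)) (max_seq y (n + 2)) (max_seq y (n + 3))
      = lyness_invariant (y $ 1) (y $ 2) (y $ 3) (y $ 4)"
  proof (induction n)
    case 0
    then show ?case by (simp add: numeral_2_eq_2 numeral_3_eq_3)
  next
    case (Suc n)
    have "Suc n + 1 = n + 2" "Suc n + 2 = n + 3" "Suc n + 3 = n + 4" "Suc n = n + 1" by simp_all
    then show ?case
      unfolding Suc.IH[symmetric] by (simp only: max_seq_rec lyness_invariant_step)
  qed
  then show ?thesis by (metis abs_le_lyness_invariant)
qed

text \<open>The reals that \<open>q\<close> multiplies into the integers contain 0 and are closed
  under subtraction and binary maximum, the only operations in the recurrence.\<close>

lemma max_seq_mult_Ints:
  assumes "\<And>i. q * y $ i \<in> \<int>"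
  shows "q * max_seq y n \<in> \<int>"
  using assms
proof (induction y n rule: max_seq.induct)
  case (5 y n)
  have max_Ints: "q * max u v \<in> \<int>" if "q * u \<in> \<int>" "q * v \<in> \<int>" for u v
    using that by (simp add: max_def)
  have "max_seq y (Suc (Suc (Suc (Suc n)))) =
      max (max_seq y (Suc (Suc (Suc n)))) (max (max_seq y (Suc (Suc n))) (max (max_seq y (Suc n)) 0))
        - max_seq y n"
    by simp
  then show ?case
    by (simp only: right_diff_distrib) (intro Ints_diff max_Ints 5; simp)
qed simp_all

lemma less_four_iff: "k < 4 \<longleftrightarrow> k = 0 \<or> k = 1 \<or> k = 2 \<or> k = 3" for k :: nat
  by auto

text \<open>For fixed \<open>n\<close> the term is built from the coordinates by finitely many
  maxima and subtractions, so it depends continuously on the initial tuple.\<close>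

lemma tendsto_max_seq:
  assumes "(f \<longlongrightarrow> x) F"
  shows "((\<lambda>m. max_seq (f m) n) \<longlongrightarrow> max_seq x n) F"
proof (induction n rule: less_induct)
  case (less n)
  consider "n = 0" | "n = 1" | "n = 2" | "n = 3" | k where "n = k + 4"
    by (metis less_four_iff add.commute le_Suc_ex linorder_not_less)
  then show ?case
  proof cases
    case 5
    then show ?thesis
      using less by (auto simp: max_seq_rec intro!: tendsto_intros tendsto_max)
  qed (use assms in \<open>auto simp: numeral_2_eq_2 numeral_3_eq_3 intro: tendsto_vec_nth\<close>)
qed

(* The recurrence is invertible, so a repeated state can be pulled back to index 0. *)
lemma max_seq_repeat:
  assumes "\<And>k. k < 4 \<Longrightarrow> max_seq y (m + p + k) = max_seq y (m + k)"
  shows "max_seq y (n + p) = max_seq y n"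
proof -
  define P where "P m \<longleftrightarrow> (\<forall>k<4. max_seq y (m + p + k) = max_seq y (m + k))" for m
  have P_iff: "P m \<longleftrightarrow> max_seq y (m + p) = max_seq y m \<and> max_seq y (m + p + 1) = max_seq y (m + 1)
     \<and> max_seq y (m + p + 2) = max_seq y (m + 2) \<and> max_seq y (m + p + 3) = max_seq y (m + 3)" for m
    unfolding P_def less_four_iff by auto
  have step: "P (Suc m) \<longleftrightarrow> P m" for m
  proof -
    have *: "Suc m = m + 1" "m + 1 + p = m + p + 1" "m + p + 1 + 1 = m + p + 2"
      "m + p + 1 + 2 = m + p + 3" "m + p + 1 + 3 = m + p + 4"
      "m + 1 + 1 = m + 2" "m + 1 + 2 = m + 3" "m + 1 + 3 = m + 4"
      by simp_all
    \<comment> \<open>If the three middle terms agree, so do the maxima; the terms at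
      \<open>m + 4\<close> then agree exactly when the subtracted terms at \<open>m\<close> do. This
      equivalence carries \<open>P\<close> forwards and backwards alike.\<close>
    have cancel: "max_seq y (m + p + 4) = max_seq y (m + 4)
        \<longleftrightarrow> max_seq y (m + p) = max_seq y m"
      if "max_seq y (m + p + 1) = max_seq y (m + 1)" "max_seq y (m + p + 2) = max_seq y (m + 2)"
        "max_seq y (m + p + 3) = max_seq y (m + 3)"
      unfolding max_seq_rec that by simp
    show ?thesis
      unfolding P_iff * using cancel by argo
  qed
  have "P n \<longleftrightarrow> P 0" for n by (induction n) (simp_all add: step)
  moreover have "P m" using assms by (simp add: P_def)
  ultimately show ?thesis unfolding P_iff by blast
qed

lemma finite_lattice_bounded:
  fixes q C :: real
  assumes "q > 0"
  shows "finite {v. q * v \<in> \<int> \<and> \<bar>v\<bar> \<le> C}"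
proof (rule finite_subset)
  show "{v. q * v \<in> \<int> \<and> \<bar>v\<bar> \<le> C} \<subseteq> (\<lambda>k. of_int k / q) ` {- \<lceil>q * C\<rceil>..\<lceil>q * C\<rceil>}"
  proof
    fix v assume v: "v \<in> {v. q * v \<in> \<int> \<and> \<bar>v\<bar> \<le> C}"
    then obtain k where k: "q * v = of_int k" by (auto elim: Ints_cases)
    have "\<bar>q * v\<bar> \<le> q * C" using v assms by (simp add: abs_mult)
    then have "\<bar>k\<bar> \<le> \<lceil>q * C\<rceil>" unfolding k by linarith
    moreover have "v = of_int k / q" using k assms by (simp add: field_simps)
    ultimately show "v \<in> (\<lambda>k. of_int k / q) ` {- \<lceil>q * C\<rceil>..\<lceil>q * C\<rceil>}"
      using image_eqI[where f = "\<lambda>k. of_int k / q"] by (simp add: abs_le_iff minus_le_iff)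
  qed
qed simp

lemma periodic_max_seq_lattice:
  assumes "\<And>i. q * y $ i \<in> \<int>" and "q > 0"
  shows "periodic (max_seq y)"
proof -
  let ?s = "max_seq y"
  let ?A = "{v. q * v \<in> \<int> \<and> \<bar>v\<bar> \<le> lyness_invariant (y $ 1) (y $ 2) (y $ 3) (y $ 4)}"
  let ?state = "\<lambda>n. (?s n, ?s (n + 1), ?s (n + 2), ?s (n + 3))"
  have "?s n \<in> ?A" for n
    using max_seq_mult_Ints[OF assms(1)] by (simp add: max_seq_bounded)
  then have "range ?state \<subseteq> ?A \<times> ?A \<times> ?A \<times> ?A" by blast
  moreover have "finite (?A \<times> ?A \<times> ?A \<times> ?A)"
    using finite_lattice_bounded[OF assms(2)] by (intro finite_cartesian_product)
  ultimately have "finite (range ?state)" by (rule finite_subset)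
  \<comment> \<open>Pigeonhole: infinitely many indices share finitely many states.\<close>
  then have "\<not> inj ?state" using finite_imageD infinite_UNIV_nat by blast
  then obtain m n where "?state m = ?state n" "m < n"
    unfolding inj_def by (metis linorder_neqE_nat)
  then obtain p where p: "p \<ge> 1" "?state m = ?state (m + p)"
    by (metis less_imp_add_positive Suc_le_eq One_nat_def)
  have "?s (m + p + k) = ?s (m + k)" if "k < 4" for k
  proof -
    have "k = 0 \<or> k = 1 \<or> k = 2 \<or> k = 3" using that by (simp only: less_four_iff)
    then show ?thesis using p(2) by auto
  qed
  then have "?s (n + p) = ?s n" for n by (rule max_seq_repeat)
  with p(1) show ?thesis unfolding periodic_def by blast
qed

lemma periodic_multiple:
  fixes s :: "nat \<Rightarrow> 'a" and p k n :: nat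
  assumes "\<And>n. s (n + p) = s n"
  shows "s (n + k * p) = s n"
proof (induction k)
  case (Suc k)
  have "s (n + Suc k * p) = s ((n + k * p) + p)" by (simp add: algebra_simps)
  then show ?case by (simp only: assms Suc.IH)
qed simp

lemma period_is_period:
  assumes "periodic s"
  shows "period s \<ge> 1" and "s (n + period s) = s n"
proof -
  have "period s \<ge> 1 \<and> (\<forall>n. s (n + period s) = s n)"
    using assms unfolding periodic_def period_def by (rule LeastI_ex)
  then show "period s \<ge> 1" and "s (n + period s) = s n" by blast+
qed

lemma period_dvd_imp:
  assumes "periodic s" and "period s dvd p"
  shows "s (n + p) = s n"
proof -
  obtain k where "p = k * period s" using assms(2) by (metis dvdE mult.commute)
  then show ?thesis using periodic_multiple period_is_period(2)[OF assms(1)] by metis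
qed

text \<open>Rounding down changes the scaled number by at most 1, so the error is at most
  \<open>1 / real (Suc m)\<close>; \<open>Suc m\<close> keeps the denominator nonzero.\<close>

lemma tendsto_floor_scaled: "(\<lambda>m. of_int \<lfloor>real (Suc m) * t\<rfloor> / real (Suc m)) \<longlonglongrightarrow> t"
proof (rule LIMSEQ_I)
  fix e :: real assume "e > 0"
  then obtain M where M: "inverse (real (Suc M)) < e" using reals_Archimedean by blast
  have "norm (of_int \<lfloor>real (Suc m) * t\<rfloor> / real (Suc m) - t) < e" if "m \<ge> M" for m
  proof -
    have "\<bar>of_int \<lfloor>real (Suc m) * t\<rfloor> - real (Suc m) * t\<bar> \<le> 1" by linarith
    then have "\<bar>of_int \<lfloor>real (Suc m) * t\<rfloor> - real (Suc m) * t\<bar> / real (Suc m) \<le> 1 / real (Suc m)"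
      by (intro divide_right_mono) simp_all
    moreover have "of_int \<lfloor>real (Suc m) * t\<rfloor> / real (Suc m) - t
        = (of_int \<lfloor>real (Suc m) * t\<rfloor> - real (Suc m) * t) / real (Suc m)"
      by (simp add: diff_divide_distrib)
    moreover have "1 / real (Suc m) \<le> inverse (real (Suc M))"
      using that by (simp add: field_simps)
    ultimately show ?thesis using M by (simp add: abs_divide)
  qed
  then show "\<exists>M. \<forall>m\<ge>M. norm (of_int \<lfloor>real (Suc m) * t\<rfloor> / real (Suc m) - t) < e" by blast
qed

theorem proposition2:
  fixes x :: "real ^ 4" and U :: "(real ^ 4) set"
  assumes "\<not> periodic (max_seq x)"
    and "x \<in> interior U"
  shows "\<forall>N. \<exists>y\<in>U. periodic (max_seq y) \<and> period (max_seq y) > N"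
proof (rule ccontr)
  assume "\<not> ?thesis"
  then obtain N where N: "\<And>y. y \<in> U \<Longrightarrow> periodic (max_seq y) \<Longrightarrow> period (max_seq y) \<le> N"
    by (metis linorder_not_less)
  \<comment> \<open>All four coordinates get the common denominator \<open>Suc m\<close>, which
    serves as \<open>q\<close> in \<open>periodic_max_seq_lattice\<close>.\<close>
  define f where "f m = (\<chi> i. of_int \<lfloor>real (Suc m) * x $ i\<rfloor> / real (Suc m))" for m
  have f_lim: "f \<longlonglongrightarrow> x"
    unfolding f_def by (rule vec_tendstoI) (simp only: vec_lambda_beta tendsto_floor_scaled)
  have f_periodic: "periodic (max_seq (f m))" for m
    by (rule periodic_max_seq_lattice[of "real (Suc m)"]) (simp_all add: f_def del: of_nat_Suc)
  have "eventually (\<lambda>m. f m \<in> interior U) sequentially"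
    using f_lim assms(2) by (rule topological_tendstoD[OF _ open_interior])
  then have ev: "eventually (\<lambda>m. f m \<in> U) sequentially"
    by (rule eventually_mono) (use interior_subset in blast)
  \<comment> \<open>Every period between 1 and \<open>N\<close> divides \<open>fact N\<close>, so
    this single shift fixes the sequences of all approximants in \<open>U\<close>, and the equation
    survives the limit for each \<open>n\<close>.\<close>
  have "max_seq x (n + fact N) = max_seq x n" for n
  proof -
    have "eventually (\<lambda>m. max_seq (f m) (n + fact N) = max_seq (f m) n) sequentially"
      using ev
    proof (rule eventually_mono)
      fix m assume "f m \<in> U"
      then have "period (max_seq (f m)) dvd fact N"
        using N f_periodic period_is_period(1) by (intro dvd_fact) blast+
      then show "max_seq (f m) (n + fact N) = max_seq (f m) n"
        by (rule period_dvd_imp[OF f_periodic])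
    qed
    then have "(\<lambda>m. max_seq (f m) n) \<longlonglongrightarrow> max_seq x (n + fact N)"
      using tendsto_max_seq[OF f_lim] by (rule Lim_transform_eventually[rotated])
    then show ?thesis
      using tendsto_max_seq[OF f_lim] by (rule LIMSEQ_unique)
  qed
  then have "periodic (max_seq x)"
    unfolding periodic_def by (intro exI[of _ "fact N"]) (simp add: fact_ge_1)
  with assms(1) show False by contradiction
qed

end
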